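(* Let $q\geq 2$ and $n\geq 2$ be integers. The map $d\colon(\mathbb{R}^q)^n\to\mathbb{R}_+$ that carries $(x_1,\ldots,x_n)$ into the length of the Euclidean Steiner tree constructed on the points $x_1,\ldots,x_n$ is an $n$-distance on $\mathbb{R}^q$. Moreover, its best constant satisfies $K^*_n\leq\frac{2}{n}$, and this inequality is strict whenever $n\geq 3$.
   Context: $\mathbb{R}_+=[0,+\infty[$. The Euclidean Steiner tree constructed on points $x_1,\ldots,x_n\in\mathbb{R}^q$ is the shortest network (in the Euclidean sense) connecting these points, where auxiliary points (Steiner points) may be added in order to minimize the total length. Thus its length is the minimum, over all finite sets $S\subset\mathbb{R}^q$, of the total length of a minimum spanning tree of the complete Euclidean graph (edge lengths equal to Euclidean distances between endpoints) with vertex set $\{x_1,\ldots,x_n\}\cup S$. For a set $X$ with at least two elements and an integer $n\geq 2$, an $n$-distance on $X$ is a map $d\colon X^n\to\mathbb{R}_+$ such that: (i) $d(x_1,\ldots,x_n)=0$ if and only if $x_1=\cdots=x_n$; (ii) $d$ is invariant under any permutation of its arguments; (iii) (simplex inequality) $d(x_1,\ldots,x_n)\leq\sum_{i=1}^n d(x_1,\ldots,x_n)_i^z$ for all $x_1,\ldots,x_n,z\in X$, where $d(x_1,\ldots,x_n)_i^z$ denotes the value obtained from $d(x_1,\ldots,x_n)$ by replacing its $i$th argument by $z$. The best constant associated with an $n$-distance $d$ on $X$ is $$K^*_n=\sup\left\{\frac{d(x_1,\ldots,x_n)}{\sum_{i=1}^n d(x_1,\ldots,x_n)_i^z}: x_1,\ldots,x_n,z\in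 X,\ |\{x_1,\ldots,x_n\}|\geq 2\right\}.$$ *)

theory Defs
  imports "HOL-Analysis.Analysis" "HOL-Combinatorics.Permutations"
begin

section \<open>\<open>n\<close>-distances\<close>

text \<open>Elements of \<open>X\<^sup>n\<close> are lists of length \<open>n\<close>, with arguments numbered from \<open>0\<close>. The value
  \<open>d(x\<^sub>1,\<dots>,x\<^sub>n)\<^sub>i\<^sup>z\<close> is then \<open>d (xs[i := z])\<close>.\<close>

definition tuples :: "nat \<Rightarrow> 'a set \<Rightarrow> 'a list set" where
  "tuples n X = {xs. length xs = n \<and> set xs \<subseteq> X}"

definition n_distance :: "nat \<Rightarrow> 'a set \<Rightarrow> ('a list \<Rightarrow> real) \<Rightarrow> bool" where
  "n_distance n X d \<longleftrightarrow>
     n \<ge> 2 \<and> (\<exists>x\<in>X. \<exists>y\<in>X. x \<noteq> y) \<and>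
     (\<forall>xs\<in>tuples n X. d xs \<ge> 0) \<and>
     (\<forall>xs\<in>tuples n X. d xs = 0 \<longleftrightarrow> (\<forall>i<n. \<forall>j<n. xs ! i = xs ! j)) \<and>
     (\<forall>xs\<in>tuples n X. \<forall>p. p permutes {..<n} \<longrightarrow> d (permute_list p xs) = d xs) \<and>
     (\<forall>xs\<in>tuples n X. \<forall>z\<in>X. d xs \<le> (\<Sum>i<n. d (xs[i := z])))"

text \<open>For an \<open>n\<close>-distance the set below is nonempty and, by the simplex inequality, bounded above
  by \<open>1\<close>; its denominators are positive. So the real supremum is the intended one.\<close>

definition best_constant :: "nat \<Rightarrow> 'a set \<Rightarrow> ('a list \<Rightarrow> real) \<Rightarrow> real" where
  "best_constant n X d =
     Sup {d xs / (\<Sum>i<n. d (xs[i := z])) | xs z. xs \<in> tuples n X \<and> z \<in> X \<and> card (set xs) \<ge> 2}"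

section \<open>Minimum spanning trees and Steiner trees\<close>

text \<open>An undirected simple graph is given by a vertex set \<open>V\<close> and a set \<open>E\<close> of two-element
  subsets of \<open>V\<close>.\<close>

definition complete_edges :: "'a set \<Rightarrow> 'a set set" where
  "complete_edges V = {{u, v} | u v. u \<in> V \<and> v \<in> V \<and> u \<noteq> v}"

definition graph_connected :: "'a set \<Rightarrow> 'a set set \<Rightarrow> bool" where
  "graph_connected V E \<longleftrightarrow> (\<forall>u\<in>V. \<forall>v\<in>V. (u, v) \<in> {(a, b). {a, b} \<in> E}\<^sup>*)"

definition graph_cycle :: "'a set set \<Rightarrow> 'a list \<Rightarrow> bool" where
  "graph_cycle E p \<longleftrightarrow>
     length p \<ge> 3 \<and> distinct p \<and> (\<forall>i<length p. {p ! i, p ! (Suc i mod length p)} \<in> E)"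

definition spanning_tree :: "'a set \<Rightarrow> 'a set set \<Rightarrow> bool" where
  "spanning_tree V E \<longleftrightarrow>
     E \<subseteq> complete_edges V \<and> graph_connected V E \<and> (\<nexists>p. graph_cycle E p)"

text \<open>The length of the edge \<open>{u, v}\<close> is \<open>dist u v\<close>, which is the diameter of this set
  (see \<open>diameter_edge\<close>).\<close>

definition total_length :: "'a::euclidean_space set set \<Rightarrow> real" where
  "total_length E = (\<Sum>e\<in>E. diameter e)"

lemma diameter_edge: "diameter {u, v} = dist u (v::'a::metric_space)"
proof (rule antisym)
  show "diameter {u, v} \<le> dist u v"
    unfolding diameter_def by (auto simp: dist_commute intro!: cSup_least)
  show "dist u v \<le> diameter {u, v}"
    by (rule diameter_bounded_bound) auto
qed

definition mst_length :: "'a::euclidean_space set \<Rightarrow> real" where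
  "mst_length V = Min {total_length E | E. spanning_tree V E}"

text \<open>The minimum over all finite sets of Steiner points is written as an infimum; the two agree
  since the minimum is classically attained (with at most \<open>n - 2\<close> Steiner points).\<close>

definition steiner_tree_length :: "'a::euclidean_space list \<Rightarrow> real" where
  "steiner_tree_length xs = Inf {mst_length (set xs \<union> S) | S. finite S}"

end

theory Submission
  imports Defs
begin

text \<open>
  Write \<open>d\<close> for the Steiner length of \<open>x\<^sub>1,\<dots>,x\<^sub>n\<close> and \<open>d\<^sub>i\<close> for the Steiner length after \<open>x\<^sub>i\<close> has been
  replaced by \<open>z\<close>. Two networks that share a point unite to a network, so the Steiner length is
  subadditive on overlapping point sets (\<open>steiner_tree_length_union\<close>). For \<open>i \<noteq> j\<close> the networks of
  \<open>d\<^sub>i\<close> and \<open>d\<^sub>j\<close> share \<open>z\<close> and together contain all \<open>x\<^sub>l\<close>; hence \<open>d \<le> d\<^sub>i + d\<^sub>j\<close>. Every two of the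
  excesses \<open>d\<^sub>i - d/2\<close> thus have a nonnegative sum, so all of them together do, which is
  \<open>n/2 * d \<le> \<Sum>\<^sub>i d\<^sub>i\<close>. This is the bound \<open>2/n\<close>, and it implies the simplex inequality.

  Strictness has to be uniform in the points, since the best constant is a supremum. It comes from an
  explicit gain for three distinct indices \<open>i, j, k\<close>. Joining \<open>x\<^sub>i\<close> to \<open>z\<close> by a segment shows
  \<open>d \<le> d\<^sub>i + |z - x\<^sub>i|\<close>, and likewise for \<open>k\<close>. On the other hand the network of \<open>d\<^sub>j\<close> contains \<open>z\<close>,
  \<open>x\<^sub>i\<close> and \<open>x\<^sub>k\<close>, and a network is at least as long as half the perimeter of any triangle on its points
  (\<open>steiner_tree_length_ge_half_perimeter\<close>). Together,
  \<open>2 d\<^sub>j + d\<^sub>i + d\<^sub>k \<ge> 2 d + |x\<^sub>i - x\<^sub>k|\<close>. Finally the star centred at the first point is a network, so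
  one of the \<open>n\<close> segments from the first point to the given points has length at least \<open>d/n\<close>. Taking
  its ends as \<open>x\<^sub>i\<close> and \<open>x\<^sub>k\<close> gives \<open>\<Sum>\<^sub>i d\<^sub>i \<ge> (n + 1/n)/2 * d\<close>, hence a best constant of at most
  \<open>2 / (n + 1/n)\<close>.

  The facts about graphs rest on trees that are built by attaching one leaf at a time: every
  connected graph contains a spanning one, they have no cycles, and the half perimeter bound follows
  by induction along their construction.
\<close>

section \<open>Trees built by attaching leaves\<close>

inductive leaf_built :: "'a set \<Rightarrow> 'a set set \<Rightarrow> bool" where
  root: "leaf_built {r} {}"
| leaf: "leaf_built V E \<Longrightarrow> u \<in> V \<Longrightarrow> w \<notin> V \<Longrightarrow> leaf_built (insert w V) (insert {u, w} E)"

lemma leaf_built_edges: "leaf_built V E \<Longrightarrow> E \<subseteq> complete_edges V"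
proof (induction rule: leaf_built.induct)
  case (leaf V E u w)
  have "{u, w} \<in> complete_edges (insert w V)"
    using leaf.hyps unfolding complete_edges_def by blast
  moreover have "complete_edges V \<subseteq> complete_edges (insert w V)"
    unfolding complete_edges_def by blast
  ultimately show ?case using leaf.IH by blast
qed simp

lemma finite_complete_edges:
  assumes "finite V" shows "finite (complete_edges V)"
  by (rule finite_subset[of _ "Pow V"]) (use assms in \<open>auto simp: complete_edges_def\<close>)

lemma graph_reachable_sym:
  "(u, v) \<in> {(a, b). {a, b} \<in> E}\<^sup>* \<Longrightarrow> (v, u) \<in> {(a, b). {a, b} \<in> E}\<^sup>*"
  by (rule symD[OF sym_rtrancl]) (auto simp: sym_def insert_commute)

lemma graph_reachable_mono:
  "E \<subseteq> F \<Longrightarrow> (u, v) \<in> {(a, b). {a, b} \<in> E}\<^sup>* \<Longrightarrow> (u, v) \<in> {(a, b). {a, b} \<in> F}\<^sup>*"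
  by (erule rtrancl_mono[THEN subsetD, rotated]) auto

lemma graph_connected_union:
  assumes V: "graph_connected V E" and W: "graph_connected W F" and z: "z \<in> V" "z \<in> W"
  shows "graph_connected (V \<union> W) (E \<union> F)"
proof -
  have "(u, z) \<in> {(a, b). {a, b} \<in> E \<union> F}\<^sup>*" if "u \<in> V \<union> W" for u
    using that V W z graph_reachable_mono[of E "E \<union> F" u z] graph_reachable_mono[of F "E \<union> F" u z]
    unfolding graph_connected_def by blast
  then show ?thesis
    unfolding graph_connected_def by (blast intro: rtrancl_trans dest: graph_reachable_sym)
qed

lemma graph_connected_edge: "graph_connected {u, w} {{u, w}}"
  unfolding graph_connected_def by (auto intro!: r_into_rtrancl simp: insert_commute)

lemma leaf_built_connected: "leaf_built V E \<Longrightarrow> graph_connected V E"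
proof (induction rule: leaf_built.induct)
  case (root r)
  show ?case by (simp add: graph_connected_def)
next
  case (leaf V E u w)
  have "graph_connected (V \<union> {u, w}) (E \<union> {{u, w}})"
    by (rule graph_connected_union[OF leaf.IH graph_connected_edge]) (use leaf.hyps in auto)
  moreover have "V \<union> {u, w} = insert w V" using leaf.hyps by auto
  ultimately show ?case by simp
qed

text \<open>A cycle has two different edges at each of its vertices, whereas the leaf attached last has
  only one. So a cycle avoids that leaf and already lies in the smaller tree.\<close>

lemma leaf_built_acyclic: "leaf_built V E \<Longrightarrow> \<not> graph_cycle E p"
proof (induction rule: leaf_built.induct)
  case (root r)
  show ?case by (auto simp: graph_cycle_def intro!: exI[of _ 0])
next
  case (leaf V E u w)
  show ?case
  proof
    assume cyc: "graph_cycle (insert {u, w} E) p"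
    define m where "m = length p"
    have m: "m \<ge> 3" and dist: "distinct p"
      and edge: "\<And>i. i < m \<Longrightarrow> {p ! i, p ! (Suc i mod m)} \<in> insert {u, w} E"
      using cyc by (auto simp: graph_cycle_def m_def)
    have wE: "e \<in> E \<Longrightarrow> w \<notin> e" for e
      using leaf_built_edges[OF leaf.hyps(1)] leaf.hyps(3) by (auto simp: complete_edges_def)
    have uw: "u \<noteq> w" using leaf.hyps by auto
    have w_edge: "b = u" if "{w, b} \<in> insert {u, w} E" for b
      using that wE[of "{w, b}"] uw by (auto simp: doubleton_eq_iff)
    have "w \<notin> set p"
    proof
      assume "w \<in> set p"
      then obtain i where i: "i < m" "p ! i = w" by (auto simp: in_set_conv_nth m_def)
      \<comment> \<open>the predecessor of \<open>i\<close> in the cyclic order\<close>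
      define j where "j = (if i = 0 then m - 1 else i - 1)"
      have j: "j < m" "Suc j mod m = i" using i m by (auto simp: j_def)
      have ne: "j \<noteq> Suc i mod m"
        using i m by (cases "Suc i = m") (auto simp: j_def)
      have "p ! (Suc i mod m) = u" using edge[OF i(1)] i w_edge by simp
      moreover have "p ! j = u" using edge[OF j(1)] j i w_edge by (simp add: insert_commute)
      moreover have "Suc i mod m < m" using m by simp
      ultimately show False using dist ne j(1) by (metis m_def nth_eq_iff_index_eq)
    qed
    have "{p ! i, p ! (Suc i mod m)} \<in> E" if "i < m" for i
    proof -
      have "Suc i mod m < m" using m by simp
      then have "p ! i \<noteq> w" "p ! (Suc i mod m) \<noteq> w"
        using \<open>w \<notin> set p\<close> that nth_mem unfolding m_def by metis+
      then show ?thesis using edge[OF that] by (auto simp: doubleton_eq_iff)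
    qed
    then have "graph_cycle E p" using m dist by (simp add: graph_cycle_def m_def)
    then show False using leaf.IH by blast
  qed
qed

lemma leaf_built_spanning_tree: "leaf_built V E \<Longrightarrow> spanning_tree V E"
  using leaf_built_edges leaf_built_connected leaf_built_acyclic
  unfolding spanning_tree_def by blast

lemma reachable_exits_set:
  assumes "(a, b) \<in> r\<^sup>*" "a \<in> U" "b \<notin> U"
  shows "\<exists>u w. (u, w) \<in> r \<and> u \<in> U \<and> w \<notin> U"
  using assms by (induction rule: rtrancl_induct) auto

text \<open>Leaves are attached inside the given graph for as long as possible. If a vertex were missing at
  the end, a walk to it would leave the tree along an edge that attaches one more leaf.\<close>

lemma connected_has_leaf_built:
  assumes fin: "finite V" and ne: "V \<noteq> {}" and sub: "E \<subseteq> complete_edges V"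
    and con: "graph_connected V E"
  shows "\<exists>F\<subseteq>E. leaf_built V F"
proof -
  obtain r where r: "r \<in> V" using ne by blast
  define S where "S = {U. U \<subseteq> V \<and> (\<exists>F\<subseteq>E. leaf_built U F)}"
  have "finite S" unfolding S_def using fin by simp
  moreover have "{r} \<in> S" unfolding S_def using r leaf_built.root[of r] by auto
  then have "S \<noteq> {}" by (rule ex_in_conv[THEN iffD1, OF exI])
  ultimately have "\<exists>U\<in>S. \<forall>W\<in>S. U \<subseteq> W \<longrightarrow> U = W"
    by (rule finite_has_maximal)
  then obtain U where U: "U \<in> S" and max: "\<forall>W\<in>S. U \<subseteq> W \<longrightarrow> U = W"
    by (rule bexE)
  from U obtain F where UV: "U \<subseteq> V" and F: "F \<subseteq> E" "leaf_built U F"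
    unfolding S_def by auto
  have "U = V"
  proof (rule ccontr)
    assume "U \<noteq> V"
    then obtain b where b: "b \<in> V" "b \<notin> U" using UV by auto
    obtain a where a: "a \<in> U" using F(2) by (cases rule: leaf_built.cases) auto
    have "(a, b) \<in> {(a, b). {a, b} \<in> E}\<^sup>*"
      using con a b(1) UV by (auto simp: graph_connected_def)
    from reachable_exits_set[OF this a b(2)]
    obtain u w where uw: "{u, w} \<in> E" "u \<in> U" "w \<notin> U" by auto
    have "w \<in> V" using uw(1) sub by (auto simp: complete_edges_def doubleton_eq_iff)
    moreover have "insert {u, w} F \<subseteq> E" using F(1) uw(1) by simp
    ultimately have "insert w U \<in> S"
      using leaf_built.leaf[OF F(2) uw(2,3)] UV unfolding S_def by (intro CollectI conjI exI) auto
    from bspec[OF max this] have "U = insert w U" by auto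
    with uw(3) show False by (metis insertI1)
  qed
  then show ?thesis using F by auto
qed

section \<open>Lengths of connected graphs\<close>

lemma diameter_edge_nonneg:
  assumes "E \<subseteq> complete_edges V" "e \<in> E" shows "diameter (e :: 'a::metric_space set) \<ge> 0"
proof -
  obtain u v where "e = {u, v}" using assms by (auto simp: complete_edges_def)
  then show ?thesis by (simp add: diameter_edge)
qed

lemma total_length_nonneg: "E \<subseteq> complete_edges V \<Longrightarrow> total_length E \<ge> 0"
  unfolding total_length_def by (intro sum_nonneg diameter_edge_nonneg)

lemma total_length_mono:
  assumes "finite V" "E \<subseteq> complete_edges V" "F \<subseteq> E"
  shows "total_length F \<le> total_length E"
  unfolding total_length_def
  by (intro sum_mono2 finite_subset[OF assms(2) finite_complete_edges[OF assms(1)]])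
     (use assms diameter_edge_nonneg[OF assms(2)] in auto)

lemma total_length_union_le:
  assumes V: "finite V" "E \<subseteq> complete_edges V" and W: "finite W" "F \<subseteq> complete_edges W"
  shows "total_length (E \<union> F) \<le> total_length E + total_length F"
proof -
  have "finite E" "finite F"
    using assms finite_complete_edges finite_subset by blast+
  then have "total_length (E \<union> F) + total_length (E \<inter> F) = total_length E + total_length F"
    unfolding total_length_def by (rule sum.union_inter)
  moreover have "total_length (E \<inter> F) \<ge> 0"
    using V(2) by (intro total_length_nonneg[of _ V]) auto
  ultimately show ?thesis by simp
qed

text \<open>Attaching a leaf \<open>w\<close> at \<open>u\<close> increases the perimeter of a triangle by at most twice the length of
  the new edge: moving all corners at \<open>w\<close> to \<open>u\<close> affects at most two of the three sides, because a
  side with both ends at \<open>w\<close> has length \<open>0\<close> before and after. Finiteness of \<open>E\<close> is carried along so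
  that the sum over \<open>E\<close> can be split.\<close>

lemma leaf_built_half_perimeter:
  "leaf_built V E \<Longrightarrow> a \<in> V \<Longrightarrow> b \<in> V \<Longrightarrow> c \<in> V \<Longrightarrow>
     finite E \<and> dist a b + dist b c + dist a c \<le> 2 * total_length E"
proof (induction arbitrary: a b c rule: leaf_built.induct)
  case (root r)
  then show ?case by (simp add: total_length_def)
next
  case (leaf V E u w)
  define mv where "mv x = (if x = w then u else x)" for x
  have mv: "mv a \<in> V" "mv b \<in> V" "mv c \<in> V" using leaf.prems leaf.hyps by (auto simp: mv_def)
  note IH = leaf.IH[OF mv]
  have "{u, w} \<notin> E"
    using leaf_built_edges[OF leaf.hyps(1)] leaf.hyps(3)
    by (auto simp: complete_edges_def doubleton_eq_iff)
  then have "total_length (insert {u, w} E) = dist u w + total_length E"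
    using IH by (simp add: total_length_def diameter_edge)
  moreover have "dist a b + dist b c + dist a c
      \<le> dist (mv a) (mv b) + dist (mv b) (mv c) + dist (mv a) (mv c) + 2 * dist u w"
    using dist_triangle[of w a u] dist_triangle[of w b u] dist_triangle[of w c u]
      zero_le_dist[of u w]
    by (auto simp: mv_def dist_commute)
  ultimately show ?case using IH by auto
qed

lemma connected_half_perimeter:
  assumes "finite V" "E \<subseteq> complete_edges V" "graph_connected V E" "a \<in> V" "b \<in> V" "c \<in> V"
  shows "dist a b + dist b c + dist a c \<le> 2 * total_length E"
proof -
  obtain F where F: "F \<subseteq> E" "leaf_built V F"
    using connected_has_leaf_built[of V E] assms by blast
  have "dist a b + dist b c + dist a c \<le> 2 * total_length F"
    using leaf_built_half_perimeter[OF F(2) assms(4-6)] by blast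
  also have "\<dots> \<le> 2 * total_length E"
    using total_length_mono[OF assms(1,2) F(1)] by simp
  finally show ?thesis .
qed

section \<open>Steiner lengths\<close>

lemma mst_set:
  assumes "finite (V :: 'a::euclidean_space set)" "V \<noteq> {}"
  shows "finite {total_length E | E. spanning_tree V E}" (is "finite ?S")
    and "{total_length E | E. spanning_tree V E} \<noteq> {}"
proof -
  have "?S \<subseteq> total_length ` Pow (complete_edges V)" by (auto simp: spanning_tree_def)
  then show "finite ?S"
    using finite_complete_edges[OF assms(1)] by (meson finite_Pow_iff finite_imageI finite_subset)
  have "graph_connected V (complete_edges V)"
    unfolding graph_connected_def
  proof (intro ballI)
    fix u v assume "u \<in> V" "v \<in> V"
    then show "(u, v) \<in> {(a, b). {a, b} \<in> complete_edges V}\<^sup>*"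
      by (cases "u = v") (auto intro!: r_into_rtrancl simp: complete_edges_def)
  qed
  then obtain F where "leaf_built V F"
    using connected_has_leaf_built[OF assms order.refl] by blast
  then show "?S \<noteq> {}" using leaf_built_spanning_tree by blast
qed

lemma mst_length_le:
  assumes "finite V" "V \<noteq> {}" "E \<subseteq> complete_edges V" "graph_connected V E"
  shows "mst_length V \<le> total_length E"
proof -
  obtain F where F: "F \<subseteq> E" "leaf_built V F"
    using connected_has_leaf_built[OF assms] by blast
  have "mst_length V \<le> total_length F"
    unfolding mst_length_def using mst_set[OF assms(1,2)] leaf_built_spanning_tree[OF F(2)]
    by (intro Min_le) auto
  also have "\<dots> \<le> total_length E" by (rule total_length_mono[OF assms(1,3) F(1)])
  finally show ?thesis .
qed

lemma mst_length_attained: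
  assumes "finite V" "V \<noteq> {}"
  obtains E where "E \<subseteq> complete_edges V" "graph_connected V E" "mst_length V = total_length E"
proof -
  have "mst_length V \<in> {total_length E | E. spanning_tree V E}"
    unfolding mst_length_def by (rule Min_in[OF mst_set[OF assms]])
  then obtain E where "mst_length V = total_length E" "spanning_tree V E" by blast
  then show thesis by (intro that[of E]) (simp_all add: spanning_tree_def)
qed

lemma bdd_below_mst_lengths:
  assumes "xs \<noteq> []"
  shows "bdd_below {mst_length (set xs \<union> S) | S. finite S}"
proof (rule bdd_belowI[of _ 0])
  fix t assume "t \<in> {mst_length (set xs \<union> S) | S. finite S}"
  then obtain S where S: "finite S" "t = mst_length (set xs \<union> S)" by blast
  have "finite (set xs \<union> S)" "set xs \<union> S \<noteq> {}" using S assms by auto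
  then obtain E where "E \<subseteq> complete_edges (set xs \<union> S)" "mst_length (set xs \<union> S) = total_length E"
    by (rule mst_length_attained)
  then show "0 \<le> t" using S total_length_nonneg by simp
qed

lemma steiner_tree_length_le:
  assumes "xs \<noteq> []" "finite V" "set xs \<subseteq> V" "E \<subseteq> complete_edges V" "graph_connected V E"
  shows "steiner_tree_length xs \<le> total_length E"
proof -
  have "steiner_tree_length xs \<le> mst_length V"
    unfolding steiner_tree_length_def
    by (intro cInf_lower bdd_below_mst_lengths[OF assms(1)])
       (use assms in \<open>auto intro!: exI[of _ V] arg_cong[of _ _ mst_length]\<close>)
  also have "\<dots> \<le> total_length E" using assms by (intro mst_length_le) auto
  finally show ?thesis .
qed

text \<open>A lower bound only has to be checked on arbitrary connected graphs: minimality and the absence of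
  cycles disappear from the later arguments.\<close>

lemma steiner_tree_length_greatest:
  assumes "xs \<noteq> []"
    and "\<And>V E. \<lbrakk>finite V; set xs \<subseteq> V; E \<subseteq> complete_edges V; graph_connected V E\<rbrakk>
           \<Longrightarrow> t \<le> total_length E"
  shows "t \<le> steiner_tree_length xs"
  unfolding steiner_tree_length_def
proof (rule cInf_greatest)
  fix y assume "y \<in> {mst_length (set xs \<union> S) | S. finite S}"
  then obtain S where S: "finite S" "y = mst_length (set xs \<union> S)" by blast
  have "finite (set xs \<union> S)" "set xs \<union> S \<noteq> {}" using S assms(1) by auto
  then obtain E where "E \<subseteq> complete_edges (set xs \<union> S)" "graph_connected (set xs \<union> S) E"
    "mst_length (set xs \<union> S) = total_length E"
    by (rule mst_length_attained)
  then show "t \<le> y" using assms(2)[of "set xs \<union> S" E] S by simp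
qed blast

lemma steiner_tree_length_ge_half_perimeter:
  assumes "a \<in> set xs" "b \<in> set xs" "c \<in> set xs"
  shows "dist a b + dist b c + dist a c \<le> 2 * steiner_tree_length xs"
proof -
  have "(dist a b + dist b c + dist a c) / 2 \<le> steiner_tree_length xs"
  proof (rule steiner_tree_length_greatest)
    fix V E
    assume V: "finite V" "set xs \<subseteq> V" and E: "E \<subseteq> complete_edges V" "graph_connected V E"
    have "a \<in> V" "b \<in> V" "c \<in> V" using V(2) assms by auto
    from connected_half_perimeter[OF V(1) E this]
    show "(dist a b + dist b c + dist a c) / 2 \<le> total_length E" by simp
  qed (use assms in auto)
  then show ?thesis by simp
qed

lemma steiner_tree_length_nonneg:
  assumes "xs \<noteq> []" shows "0 \<le> steiner_tree_length xs"
  using steiner_tree_length_ge_half_perimeter[of "hd xs" xs "hd xs" "hd xs"] assms by simp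

text \<open>The two infima are removed one after the other, by fixing a connected graph for each of \<open>ys\<close> and
  \<open>zs\<close>. Their union is connected because both contain \<open>z\<close>.\<close>

lemma steiner_tree_length_union:
  assumes "set xs \<subseteq> set ys \<union> set zs" "xs \<noteq> []" "z \<in> set ys" "z \<in> set zs"
  shows "steiner_tree_length xs \<le> steiner_tree_length ys + steiner_tree_length zs"
proof -
  have "steiner_tree_length xs - steiner_tree_length ys \<le> steiner_tree_length zs"
  proof (rule steiner_tree_length_greatest)
    fix W F assume W: "finite W" "set zs \<subseteq> W" "F \<subseteq> complete_edges W" "graph_connected W F"
    have "steiner_tree_length xs - total_length F \<le> steiner_tree_length ys"
    proof (rule steiner_tree_length_greatest)
      fix V E assume V: "finite V" "set ys \<subseteq> V" "E \<subseteq> complete_edges V" "graph_connected V E"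
      have "E \<union> F \<subseteq> complete_edges (V \<union> W)"
        using V(3) W(3) unfolding complete_edges_def by blast
      moreover have "graph_connected (V \<union> W) (E \<union> F)"
        using assms V W by (intro graph_connected_union[of _ _ _ _ z]) auto
      ultimately have "steiner_tree_length xs \<le> total_length (E \<union> F)"
        using assms V W by (intro steiner_tree_length_le[of xs "V \<union> W"]) auto
      then show "steiner_tree_length xs - total_length F \<le> total_length E"
        using total_length_union_le[OF V(1,3) W(1,3)] by simp
    qed (use assms in auto)
    then show "steiner_tree_length xs - steiner_tree_length ys \<le> total_length F" by simp
  qed (use assms in auto)
  then show ?thesis by simp
qed

lemma steiner_tree_length_same:
  fixes x :: "'a::euclidean_space"
  assumes "set xs = {x}" shows "steiner_tree_length xs = 0"
proof (rule antisym)
  have "steiner_tree_length xs \<le> total_length ({} :: 'a set set)"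
    by (rule steiner_tree_length_le[of _ "{x}"])
       (use assms in \<open>auto simp: graph_connected_def\<close>)
  then show "steiner_tree_length xs \<le> 0" by (simp add: total_length_def)
  show "0 \<le> steiner_tree_length xs" using assms by (intro steiner_tree_length_nonneg) auto
qed

lemma steiner_tree_length_segment: "steiner_tree_length [x, y] \<le> dist x y"
proof (cases "x = y")
  case True
  then show ?thesis using steiner_tree_length_same[of "[x, y]" x] by simp
next
  case False
  have "steiner_tree_length [x, y] \<le> total_length {{x, y}}"
    by (rule steiner_tree_length_le[OF _ _ _ _ graph_connected_edge])
       (use False in \<open>auto simp: complete_edges_def\<close>)
  then show ?thesis by (simp add: total_length_def diameter_edge)
qed

lemma steiner_tree_length_star: "steiner_tree_length (x # ys) \<le> (\<Sum>y\<leftarrow>ys. dist x y)"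
proof (induction ys)
  case Nil
  then show ?case using steiner_tree_length_same[of "[x]" x] by simp
next
  case (Cons y ys)
  have "steiner_tree_length (x # y # ys) \<le> steiner_tree_length (x # ys) + steiner_tree_length [x, y]"
    by (rule steiner_tree_length_union[of _ _ _ x]) auto
  then show ?case using Cons steiner_tree_length_segment[of x y] by simp
qed

section \<open>Replacing one point\<close>

lemma nth_mem_update:
  assumes "l < length xs" "l \<noteq> i" shows "xs ! l \<in> set (xs[i := z])"
  using assms by (metis length_list_update nth_list_update_neq nth_mem)

lemma replace_pair:
  assumes "i < length xs" "j < length xs" "i \<noteq> j"
  shows "steiner_tree_length xs
    \<le> steiner_tree_length (xs[i := z]) + steiner_tree_length (xs[j := z])"
proof (rule steiner_tree_length_union)
  show "set xs \<subseteq> set (xs[i := z]) \<union> set (xs[j := z])"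
    using assms(3) by (auto simp: in_set_conv_nth[of _ xs]) (metis nth_mem_update)
qed (use assms in \<open>auto intro: set_update_memI\<close>)

lemma replace_segment:
  assumes "i < length xs"
  shows "steiner_tree_length xs \<le> steiner_tree_length (xs[i := z]) + dist z (xs ! i)"
proof -
  have "steiner_tree_length xs \<le> steiner_tree_length (xs[i := z]) + steiner_tree_length [z, xs ! i]"
  proof (rule steiner_tree_length_union)
    show "set xs \<subseteq> set (xs[i := z]) \<union> set [z, xs ! i]"
      by (auto simp: in_set_conv_nth[of _ xs]) (metis nth_mem_update)
  qed (use assms in \<open>auto intro: set_update_memI\<close>)
  then show ?thesis using steiner_tree_length_segment[of z "xs ! i"] by simp
qed

text \<open>The sides at \<open>z\<close> of the triangle on \<open>z\<close>, \<open>xs ! i\<close>, \<open>xs ! k\<close> are at least the loss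
  \<open>steiner_tree_length xs - steiner_tree_length (xs[l := z])\<close> for \<open>l = i, k\<close>, and the graph with the
  \<open>j\<close>-th point replaced has to span that triangle.\<close>

lemma replace_triple:
  assumes "i < length xs" "j < length xs" "k < length xs" "i \<noteq> j" "k \<noteq> j"
  shows "2 * steiner_tree_length xs + dist (xs ! i) (xs ! k)
    \<le> 2 * steiner_tree_length (xs[j := z]) + steiner_tree_length (xs[i := z])
      + steiner_tree_length (xs[k := z])"
proof -
  have "dist z (xs ! i) + dist (xs ! i) (xs ! k) + dist z (xs ! k)
      \<le> 2 * steiner_tree_length (xs[j := z])"
    using assms by (intro steiner_tree_length_ge_half_perimeter nth_mem_update set_update_memI)
  then show ?thesis
    using replace_segment[OF assms(1), of z] replace_segment[OF assms(3), of z] by linarith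
qed

lemma far_point_exists:
  assumes "xs \<noteq> []"
  shows "\<exists>i<length xs. steiner_tree_length xs / length xs \<le> dist (xs ! i) (xs ! 0)"
proof (rule ccontr)
  assume "\<not> ?thesis"
  then have less: "dist (xs ! 0) (xs ! i) < steiner_tree_length xs / length xs"
    if "i < length xs" for i
    using that by (auto simp: dist_commute not_le)
  \<comment> \<open>repeating the centre leaves the point set unchanged and lets the sum run over all indices\<close>
  have "steiner_tree_length (hd xs # xs) \<le> (\<Sum>y\<leftarrow>xs. dist (hd xs) y)"
    by (rule steiner_tree_length_star)
  also have "steiner_tree_length (hd xs # xs) = steiner_tree_length xs"
    using assms by (simp add: steiner_tree_length_def insert_absorb)
  also have "(\<Sum>y\<leftarrow>xs. dist (hd xs) y) = (\<Sum>i<length xs. dist (xs ! 0) (xs ! i))"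
    using assms by (simp add: sum_list_sum_nth hd_conv_nth atLeast0LessThan)
  also have "\<dots> < (\<Sum>i<length xs. steiner_tree_length xs / length xs)"
    using assms less by (intro sum_strict_mono) auto
  also have "\<dots> = steiner_tree_length xs" using assms by simp
  finally show False by simp
qed

text \<open>Two negative values would violate the hypothesis, so only the minimum can be negative, and any
  second value makes up for it.\<close>

lemma sum_nonneg_if_pairs:
  fixes f :: "'i \<Rightarrow> real"
  assumes fin: "finite I" and card: "card I \<ge> 2"
    and pair: "\<And>i j. i \<in> I \<Longrightarrow> j \<in> I \<Longrightarrow> i \<noteq> j \<Longrightarrow> 0 \<le> f i + f j"
  shows "0 \<le> sum f I"
proof -
  have "I \<noteq> {}" using card by auto
  then obtain m where m: "m \<in> I" "\<And>l. l \<in> I \<Longrightarrow> f m \<le> f l"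
    using fin ex_min_if_finite[of "f ` I"] by (metis (no_types) arg_min_if_finite(1) arg_min_least)
  have pos: "0 \<le> f l" if "l \<in> I - {m}" for l
    using pair[of m l] m that by force
  have "card (I - {m}) \<ge> 1" using m card fin by simp
  then obtain j where j: "j \<in> I - {m}" by (metis card.empty ex_in_conv not_one_le_zero)
  have "sum f I = f m + (f j + sum f (I - {m} - {j}))"
    using fin m(1) j by (simp add: sum.remove)
  moreover have "0 \<le> sum f (I - {m} - {j})" by (intro sum_nonneg) (use pos in auto)
  moreover have "0 \<le> f m + f j" using pair[of m j] m(1) j by auto
  ultimately show ?thesis by linarith
qed

text \<open>The third index is chosen to minimise \<open>f\<close> over the complement of \<open>{i, k}\<close>, so that every value
  outside the triple is nonnegative and the gain of the triple survives.\<close>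

lemma sum_ge_if_pairs_triple:
  fixes f :: "'i \<Rightarrow> real"
  assumes fin: "finite I" and card: "card I \<ge> 3"
    and pair: "\<And>i j. i \<in> I \<Longrightarrow> j \<in> I \<Longrightarrow> i \<noteq> j \<Longrightarrow> 0 \<le> f i + f j"
    and ik: "i \<in> I" "k \<in> I" "i \<noteq> k"
    and triple: "\<And>j. j \<in> I \<Longrightarrow> j \<noteq> i \<Longrightarrow> j \<noteq> k \<Longrightarrow> g \<le> 2 * f j + f i + f k"
  shows "g / 2 \<le> sum f I"
proof -
  let ?J = "I - {i} - {k}"
  have "card ?J \<ge> 1" using fin card ik by simp
  then have "?J \<noteq> {}" by (metis card.empty not_one_le_zero)
  then obtain j where j: "j \<in> ?J" "\<And>l. l \<in> ?J \<Longrightarrow> f j \<le> f l"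
    using fin by (metis arg_min_if_finite(1) arg_min_least finite_Diff)
  have "0 \<le> sum f (?J - {j})"
  proof (rule sum_nonneg)
    fix l assume l: "l \<in> ?J - {j}"
    then show "0 \<le> f l" using pair[of j l] j by force
  qed
  moreover have "sum f I = f i + (f k + (f j + sum f (?J - {j})))"
    using fin ik j(1) sum.remove[of I i f] sum.remove[of "I - {i}" k f] sum.remove[of ?J j f]
    by simp
  moreover have "0 \<le> f i + f k" using pair ik by blast
  moreover have "g \<le> 2 * f j + f i + f k" using triple j(1) by auto
  ultimately show ?thesis by linarith
qed

lemma replace_sum:
  assumes "length xs = n" "n \<ge> 2"
  shows "real n / 2 * steiner_tree_length xs \<le> (\<Sum>i<n. steiner_tree_length (xs[i := z]))"
proof -
  have "0 \<le> (\<Sum>i<n. steiner_tree_length (xs[i := z]) - steiner_tree_length xs / 2)"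
  proof (rule sum_nonneg_if_pairs)
    fix i j assume "i \<in> {..<n}" "j \<in> {..<n}" "i \<noteq> j"
    then show "0 \<le> steiner_tree_length (xs[i := z]) - steiner_tree_length xs / 2 +
        (steiner_tree_length (xs[j := z]) - steiner_tree_length xs / 2)"
      using replace_pair[of i xs j z] assms by simp
  qed (use assms in auto)
  then show ?thesis by (simp add: sum_subtractf)
qed

lemma replace_sum_gain:
  assumes len: "length xs = n" and n: "n \<ge> 3" and pos: "steiner_tree_length xs > 0"
  shows "(real n + 1 / real n) / 2 * steiner_tree_length xs
    \<le> (\<Sum>i<n. steiner_tree_length (xs[i := z]))"
proof -
  let ?d = "steiner_tree_length xs"
  have "xs \<noteq> []" using len n by auto
  then obtain i where i: "i < n" "?d / n \<le> dist (xs ! i) (xs ! 0)"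
    using far_point_exists[of xs] len by auto
  have "?d / n > 0" using pos n by simp
  then have i0: "i \<noteq> 0" using i(2) by (intro notI) simp
  have "?d / n / 2 \<le> (\<Sum>i<n. steiner_tree_length (xs[i := z]) - ?d / 2)"
  proof (rule sum_ge_if_pairs_triple[of _ _ i 0])
    fix i j assume "i \<in> {..<n}" "j \<in> {..<n}" "i \<noteq> j"
    then show "0 \<le> steiner_tree_length (xs[i := z]) - ?d / 2 +
        (steiner_tree_length (xs[j := z]) - ?d / 2)"
      using replace_pair[of i xs j z] len by simp
  next
    fix j assume "j \<in> {..<n}" "j \<noteq> i" "j \<noteq> 0"
    then show "?d / n \<le> 2 * (steiner_tree_length (xs[j := z]) - ?d / 2) +
        (steiner_tree_length (xs[i := z]) - ?d / 2) + (steiner_tree_length (xs[0 := z]) - ?d / 2)"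
      using replace_triple[of i xs j 0 z] i len n by simp
  qed (use n i i0 in auto)
  then show ?thesis by (simp add: sum_subtractf algebra_simps add_divide_distrib)
qed

section \<open>The \<open>n\<close>-distance and its best constant\<close>

lemma steiner_tree_length_pos:
  assumes "card (set xs) \<ge> 2" shows "steiner_tree_length xs > 0"
proof -
  have "\<not> (\<exists>x. set xs \<subseteq> {x})"
    using assms by (metis card.empty card_1_singleton_iff card_mono finite.emptyI finite.insertI
        not_less_eq_eq numeral_2_eq_2 One_nat_def)
  then obtain x y where "x \<in> set xs" "y \<in> set xs" "x \<noteq> y" by (metis insertI1 subset_iff)
  then have "0 < dist x y" "dist x y \<le> steiner_tree_length xs"
    using steiner_tree_length_ge_half_perimeter[of x xs y y] by auto
  then show ?thesis by (rule less_le_trans)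
qed

lemma n_distance_steiner_tree_length:
  assumes n: "n \<ge> 2"
  shows "n_distance n (UNIV :: 'a::euclidean_space set) steiner_tree_length"
  unfolding n_distance_def
proof (intro conjI ballI allI impI)
  show "\<exists>x\<in>UNIV. \<exists>y\<in>UNIV. (x::'a) \<noteq> y"
    using nonempty_Basis nonzero_Basis by blast
next
  fix xs :: "'a list" assume xs: "xs \<in> tuples n UNIV"
  then have len: "length xs = n" by (simp add: tuples_def)
  then have ne: "xs \<noteq> []" using n by auto
  show nonneg: "steiner_tree_length xs \<ge> 0" by (rule steiner_tree_length_nonneg[OF ne])
  show "steiner_tree_length xs = 0 \<longleftrightarrow> (\<forall>i<n. \<forall>j<n. xs ! i = xs ! j)"
  proof
    assume 0: "steiner_tree_length xs = 0"
    show "\<forall>i<n. \<forall>j<n. xs ! i = xs ! j"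
    proof (intro allI impI)
      fix i j assume "i < n" "j < n"
      then have "dist (xs ! i) (xs ! j) + dist (xs ! j) (xs ! j) + dist (xs ! i) (xs ! j)
          \<le> 2 * steiner_tree_length xs"
        by (intro steiner_tree_length_ge_half_perimeter) (use len in auto)
      then show "xs ! i = xs ! j" using 0 by simp
    qed
  next
    assume same: "\<forall>i<n. \<forall>j<n. xs ! i = xs ! j"
    have "0 < n" using n by simp
    have "set xs = {xs ! 0}"
    proof (intro equalityI subsetI)
      fix x assume "x \<in> set xs"
      then obtain i where "i < n" "x = xs ! i" by (metis in_set_conv_nth len)
      then have "x = xs ! 0" using same \<open>0 < n\<close> by blast
      then show "x \<in> {xs ! 0}" by simp
    qed (use \<open>0 < n\<close> len in simp)
    then show "steiner_tree_length xs = 0" by (rule steiner_tree_length_same)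
  qed
  show "steiner_tree_length (permute_list p xs) = steiner_tree_length xs" if "p permutes {..<n}" for p
    using that len by (simp add: steiner_tree_length_def)
  show "steiner_tree_length xs \<le> (\<Sum>i<n. steiner_tree_length (xs[i := z]))" for z
  proof -
    have "1 * steiner_tree_length xs \<le> real n / 2 * steiner_tree_length xs"
      using n nonneg by (intro mult_right_mono) auto
    then show ?thesis using replace_sum[OF len n, of z] by simp
  qed
qed (use n in auto)

text \<open>A supremum over the empty set is unspecified; the two different points of \<open>X\<close> make the set of
  quotients nonempty.\<close>

lemma best_constant_le:
  fixes d :: "'a list \<Rightarrow> real"
  assumes n: "n \<ge> 2" and xy: "x \<in> X" "y \<in> X" "x \<noteq> y" and c: "c > 0"
    and bound: "\<And>xs z. \<lbrakk>xs \<in> tuples n X; z \<in> X; card (set xs) \<ge> 2\<rbrakk>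
      \<Longrightarrow> 0 < d xs \<and> c * d xs \<le> (\<Sum>i<n. d (xs[i := z]))"
  shows "best_constant n X d \<le> 1 / c"
  unfolding best_constant_def
proof (rule cSup_least)
  have "set (x # replicate (n - 1) y) = {x, y}" using n by auto
  then have "x # replicate (n - 1) y \<in> tuples n X \<and> card (set (x # replicate (n - 1) y)) \<ge> 2"
    using n xy by (auto simp: tuples_def)
  then show "{d xs / (\<Sum>i<n. d (xs[i := z])) | xs z.
      xs \<in> tuples n X \<and> z \<in> X \<and> card (set xs) \<ge> 2} \<noteq> {}" using xy(1) by blast
next
  fix t assume "t \<in> {d xs / (\<Sum>i<n. d (xs[i := z])) | xs z.
      xs \<in> tuples n X \<and> z \<in> X \<and> card (set xs) \<ge> 2}"
  then obtain xs z where t: "t = d xs / (\<Sum>i<n. d (xs[i := z]))"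
    and "xs \<in> tuples n X" "z \<in> X" "card (set xs) \<ge> 2" by blast
  then have b: "0 < d xs" "c * d xs \<le> (\<Sum>i<n. d (xs[i := z]))" using bound by auto
  have "0 < c * d xs" using b c by simp
  then have "0 < (\<Sum>i<n. d (xs[i := z]))" using b(2) by (rule less_le_trans)
  then show "t \<le> 1 / c" unfolding t using b(2) c by (simp add: pos_divide_le_eq field_simps)
qed

theorem proposition5p3:
  fixes n :: nat
  assumes "CARD('q::finite) \<ge> 2" and "n \<ge> 2"
  shows "n_distance n (UNIV :: (real ^ 'q) set) steiner_tree_length \<and>
         best_constant n (UNIV :: (real ^ 'q) set) steiner_tree_length \<le> 2 / real n \<and>
         (n \<ge> 3 \<longrightarrow> best_constant n (UNIV :: (real ^ 'q) set) steiner_tree_length < 2 / real n)"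
proof (intro conjI impI)
  show nd: "n_distance n (UNIV :: (real ^ 'q) set) steiner_tree_length"
    by (rule n_distance_steiner_tree_length[OF assms(2)])
  then obtain x y :: "real ^ 'q" where xy: "x \<in> UNIV" "y \<in> UNIV" "x \<noteq> y"
    unfolding n_distance_def by blast
  have "best_constant n (UNIV :: (real ^ 'q) set) steiner_tree_length \<le> 1 / (real n / 2)"
    by (rule best_constant_le[OF assms(2) xy])
       (use assms(2) in \<open>auto simp: tuples_def simp del: times_divide_eq_left
          intro!: steiner_tree_length_pos replace_sum\<close>)
  then show "best_constant n (UNIV :: (real ^ 'q) set) steiner_tree_length \<le> 2 / real n" by simp
  assume n: "n \<ge> 3"
  have "best_constant n (UNIV :: (real ^ 'q) set) steiner_tree_length
      \<le> 1 / ((real n + 1 / real n) / 2)"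
  proof (rule best_constant_le[OF assms(2) xy])
    show "0 < (real n + 1 / real n) / 2" using n by (simp add: add_pos_pos)
    fix xs :: "(real ^ 'q) list" and z
    assume "xs \<in> tuples n UNIV" "card (set xs) \<ge> 2"
    then show "0 < steiner_tree_length xs \<and> (real n + 1 / real n) / 2 * steiner_tree_length xs
        \<le> (\<Sum>i<n. steiner_tree_length (xs[i := z]))"
      using steiner_tree_length_pos replace_sum_gain[OF _ n] by (auto simp: tuples_def)
  qed
  also have "\<dots> < 2 / real n" using n by (simp add: divide_strict_left_mono add_pos_pos)
  finally show "best_constant n (UNIV :: (real ^ 'q) set) steiner_tree_length < 2 / real n" .
qed

end
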